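(* Let $X$ be a real Banach space, $C\subset X$ a nonempty closed bounded convex set, $f:X\to\mathbb{R}$ a convex, continuously Fréchet differentiable function, and $g:X\to(-\infty,\infty]$ a proper, lower semicontinuous, convex function with $C\subset\{x\in X:g(x)<\infty\}$. Put $\varphi=f+g$ and assume that $\varphi$ attains its minimum over $C$. Let $\{x_k\}_{k\ge0}$ be a sequence generated by the generalized Frank-Wolfe algorithm from an arbitrary $x_0\in C$ (the subproblem defining $\bar x_k$ being solvable for each $k$). Assume: (i) the Fréchet derivative $f'$ is uniformly continuous on $C$; (ii) the stepsizes $\{\gamma_k\}\subset(0,1]$ satisfy $\lim_{k\to\infty}\gamma_k=0$ and $\sum_{k=0}^\infty\gamma_k=\infty$. Then $\lim_{k\to\infty}\varphi(x_k)=\varphi^*:=\inf_{x\in C}\varphi(x)$.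
   Context: $\langle\cdot,\cdot\rangle$ is the pairing between the dual $X^*$ and $X$. Generalized Frank-Wolfe algorithm for $\min_{x\in C}\varphi(x)=f(x)+g(x)$: given $x_0\in C$, for each $k\ge0$ choose $\bar x_k\in C$ to be a minimizer of $x\mapsto\langle f'(x_k),x\rangle+g(x)$ over $C$, and set $x_{k+1}=x_k+\gamma_k(\bar x_k-x_k)$, where $\gamma_k$ is the stepsize. *)

theory Defs
  imports "HOL-Analysis.Analysis"
begin

definition proper_fun :: "('a \<Rightarrow> ereal) \<Rightarrow> bool" where
  "proper_fun g \<longleftrightarrow> (\<forall>x. g x \<noteq> -\<infinity>) \<and> (\<exists>x. g x \<noteq> \<infinity>)"

definition lsc_fun :: "('a::topological_space \<Rightarrow> ereal) \<Rightarrow> bool" where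
  "lsc_fun g \<longleftrightarrow> (\<forall>x. g x \<le> Liminf (at x) g)"

text \<open>In \<^typ>\<open>ereal\<close> we have \<^prop>\<open>0 * (\<infinity>::ereal) = 0\<close>, so the degenerate weights are
  harmless. The notion is meant for functions that never take the value \<open>-\<infinity>\<close>.\<close>

definition convex_fun :: "('a::real_vector \<Rightarrow> ereal) \<Rightarrow> bool" where
  "convex_fun g \<longleftrightarrow> (\<forall>x y. \<forall>u\<ge>0. \<forall>v\<ge>0. u + v = 1 \<longrightarrow>
     g (u *\<^sub>R x + v *\<^sub>R y) \<le> ereal u * g x + ereal v * g y)"

text \<open>\<open>f'\<close> is the derivative of the smooth part as a map into the dual space
  \<^typ>\<open>'a::real_normed_vector \<Rightarrow>\<^sub>L real\<close>, and \<open>xb\<close> is the sequence of chosen subproblem minimizers.\<close>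

definition generalized_frank_wolfe ::
  "'a::real_normed_vector set \<Rightarrow> ('a \<Rightarrow> 'a \<Rightarrow>\<^sub>L real) \<Rightarrow> ('a \<Rightarrow> ereal) \<Rightarrow> (nat \<Rightarrow> real)
    \<Rightarrow> (nat \<Rightarrow> 'a) \<Rightarrow> (nat \<Rightarrow> 'a) \<Rightarrow> bool" where
  "generalized_frank_wolfe C f' g \<gamma> x xb \<longleftrightarrow>
     x 0 \<in> C \<and>
     (\<forall>k. is_arg_min (\<lambda>y. ereal (blinfun_apply (f' (x k)) y) + g y) (\<lambda>y. y \<in> C) (xb k) \<and>
          x (Suc k) = x k + \<gamma> k *\<^sub>R (xb k - x k))"

end

theory Submission
  imports Defs
begin

text \<open>
  The gap \<open>r\<^sub>k = \<phi>(x\<^sub>k) - \<phi>\<^sup>*\<close> contracts up to a small error. The mean value theorem along the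
  segment from \<open>x\<^sub>k\<close> to \<open>x\<^sub>k\<^sub>+\<^sub>1\<close>, whose length \<open>\<gamma>\<^sub>k \<parallel>xb\<^sub>k - x\<^sub>k\<parallel>\<close> tends to zero because \<open>C\<close> is bounded,
  and the uniform continuity of \<open>f'\<close> bound the linearization error by \<open>\<epsilon> \<gamma>\<^sub>k\<close> for all large \<open>k\<close>.
  Optimality of \<open>xb\<^sub>k\<close> in the subproblem together with the gradient inequality for \<open>f\<close> then gives
  \<open>r\<^sub>k\<^sub>+\<^sub>1 \<le> (1 - \<gamma>\<^sub>k) r\<^sub>k + \<epsilon> \<gamma>\<^sub>k\<close>. Hence \<open>r\<^sub>k - \<epsilon>\<close> is eventually dominated by a multiple of
  \<open>exp (- (\<gamma>\<^sub>0 + \<dots> + \<gamma>\<^sub>k\<^sub>-\<^sub>1))\<close>, which vanishes as the stepsizes are not summable.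
\<close>

lemma has_field_derivative_along_line:
  fixes f :: "'a::real_normed_vector \<Rightarrow> real"
  assumes "(f has_derivative f') (at (a + t *\<^sub>R d))"
  shows "((\<lambda>s. f (a + s *\<^sub>R d)) has_field_derivative f' d) (at t)"
proof -
  have "((\<lambda>s. a + s *\<^sub>R d) has_derivative (\<lambda>s. s *\<^sub>R d)) (at t)"
    by (auto intro!: derivative_eq_intros)
  from has_derivative_compose[OF this assms]
  have "((\<lambda>s. f (a + s *\<^sub>R d)) has_derivative (\<lambda>s. f' (s *\<^sub>R d))) (at t)" .
  moreover have "f' (s *\<^sub>R d) = f' d * s" for s
    using has_derivative_linear[OF assms] by (simp add: linear_scale)
  ultimately show ?thesis
    by (simp add: has_field_derivative_def)
qed

lemma convex_on_along_line:
  fixes f :: "'a::real_vector \<Rightarrow> real"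
  assumes "convex_on UNIV f"
  shows "convex_on UNIV (\<lambda>s. f (a + s *\<^sub>R d))"
proof (rule convex_onI)
  fix t s r :: real
  assume "0 < t" "t < 1"
  have "a + ((1 - t) *\<^sub>R s + t *\<^sub>R r) *\<^sub>R d = (1 - t) *\<^sub>R (a + s *\<^sub>R d) + t *\<^sub>R (a + r *\<^sub>R d)"
    by (simp add: algebra_simps)
  then show "f (a + ((1 - t) *\<^sub>R s + t *\<^sub>R r) *\<^sub>R d)
      \<le> (1 - t) * f (a + s *\<^sub>R d) + t * f (a + r *\<^sub>R d)"
    using convex_onD[OF assms, of t] \<open>0 < t\<close> \<open>t < 1\<close> by simp
qed simp

text \<open>Restricting \<open>f\<close> to the line through \<open>a\<close> and \<open>b\<close>
  reduces this to the tangent inequality of a convex function of one real variable, with base point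
  0 and evaluated at 1.\<close>

lemma convex_on_above_tangent_frechet:
  fixes f :: "'a::real_normed_vector \<Rightarrow> real"
  assumes "convex_on UNIV f" and "(f has_derivative f') (at a)"
  shows "f' (b - a) \<le> f b - f a"
proof -
  have "((\<lambda>s. f (a + s *\<^sub>R (b - a))) has_field_derivative f' (b - a)) (at 0)"
    using assms(2) by (intro has_field_derivative_along_line) simp
  then show ?thesis
    using convex_on_imp_above_tangent[OF convex_on_along_line[OF assms(1)], where c = 0 and x = 1]
    by fastforce
qed

text \<open>By the mean value theorem the increment is \<open>\<gamma>\<close> times the slope at an
  intermediate point of the segment, and \<open>close\<close> controls in operator norm how far that
  slope is from the one at \<open>a\<close>.\<close>

lemma linearization_error_le:
  fixes f :: "'a::real_normed_vector \<Rightarrow> real" and f' :: "'a \<Rightarrow> 'a \<Rightarrow>\<^sub>L real"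
  assumes deriv: "\<And>z. (f has_derivative blinfun_apply (f' z)) (at z)"
    and "0 < \<gamma>"
    and close: "\<And>s. \<lbrakk>0 \<le> s; s \<le> \<gamma>\<rbrakk> \<Longrightarrow> norm (f' (a + s *\<^sub>R d) - f' a) \<le> \<epsilon>"
  shows "f (a + \<gamma> *\<^sub>R d) \<le> f a + \<gamma> * f' a d + \<gamma> * (\<epsilon> * norm d)"
proof -
  obtain s where s: "0 < s" "s < \<gamma>"
    and eq: "f (a + \<gamma> *\<^sub>R d) - f (a + 0 *\<^sub>R d) = (\<gamma> - 0) * f' (a + s *\<^sub>R d) d"
    using MVT2[OF \<open>0 < \<gamma>\<close>, of "\<lambda>s. f (a + s *\<^sub>R d)" "\<lambda>s. f' (a + s *\<^sub>R d) d"]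
      has_field_derivative_along_line[OF deriv] by blast
  have "f' (a + s *\<^sub>R d) d - f' a d = (f' (a + s *\<^sub>R d) - f' a) d"
    by (simp add: blinfun.diff_left)
  also have "\<dots> \<le> norm (f' (a + s *\<^sub>R d) - f' a) * norm d"
    using norm_blinfun[of "f' (a + s *\<^sub>R d) - f' a" d] by simp
  also have "\<dots> \<le> \<epsilon> * norm d"
    using close[of s] s by (intro mult_right_mono) auto
  finally have "\<gamma> * f' (a + s *\<^sub>R d) d \<le> \<gamma> * (f' a d + \<epsilon> * norm d)"
    using \<open>0 < \<gamma>\<close> by (intro mult_left_mono) auto
  with eq show ?thesis
    by (simp add: algebra_simps)
qed

text \<open>The index from which the contraction holds may depend on \<open>\<epsilon>\<close>, so
  the tolerance is fixed first and only the tail from that index is compared with an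
  exponential.\<close>

lemma tendsto_zero_of_eventual_contraction:
  fixes r \<gamma> :: "nat \<Rightarrow> real"
  assumes nonneg: "\<And>k. 0 \<le> r k"
    and \<gamma>: "\<And>k. \<gamma> k \<le> 1"
    and sum: "filterlim (\<lambda>n. \<Sum>k<n. \<gamma> k) at_top sequentially"
    and contr: "\<And>\<epsilon>. 0 < \<epsilon> \<Longrightarrow> \<forall>\<^sub>F k in sequentially. r (Suc k) \<le> (1 - \<gamma> k) * r k + \<gamma> k * \<epsilon>"
  shows "r \<longlonglongrightarrow> 0"
proof (rule order_tendstoI)
  fix c :: real assume "c < 0"
  then show "\<forall>\<^sub>F k in sequentially. c < r k"
    by (auto intro!: always_eventually less_le_trans[OF _ nonneg])
next
  fix c :: real assume "0 < c"
  \<comment> \<open>Half of \<open>c\<close> goes to the persistent error, the other half to the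
    decaying exponential.\<close>
  define \<epsilon> where "\<epsilon> = c / 2"
  have "0 < \<epsilon>" "\<epsilon> < c" using \<open>0 < c\<close> by (auto simp: \<epsilon>_def)
  obtain N where N: "\<And>k. N \<le> k \<Longrightarrow> r (Suc k) \<le> (1 - \<gamma> k) * r k + \<gamma> k * \<epsilon>"
    using contr[OF \<open>0 < \<epsilon>\<close>] by (auto simp: eventually_sequentially)
  define S where "S n = (\<Sum>k<n. \<gamma> k)" for n
  \<comment> \<open>Normalized so that \<open>M * exp (- S N)\<close> equals \<open>r N\<close>,
    which starts the induction.\<close>
  define M where "M = r N * exp (S N)"
  have "0 \<le> M" using nonneg by (simp add: M_def)
  have bound: "r n - \<epsilon> \<le> M * exp (- S n)" if "N \<le> n" for n
    using that
  proof (induction n rule: dec_induct)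
    case base
    show ?case using \<open>0 < \<epsilon>\<close> by (simp add: M_def mult.assoc flip: exp_add)
  next
    case (step n)
    \<comment> \<open>\<open>\<epsilon>\<close> is the fixed point of the affine recursion, so
      subtracting it leaves a purely multiplicative one.\<close>
    have "r (Suc n) - \<epsilon> \<le> (1 - \<gamma> n) * (r n - \<epsilon>)"
      using N[OF step.hyps(1)] by (simp add: algebra_simps)
    also have "\<dots> \<le> (1 - \<gamma> n) * (M * exp (- S n))"
      using step.IH \<gamma> by (intro mult_left_mono) auto
    \<comment> \<open>Uses 1 - t \<le> exp (-t). This comes after the induction hypothesis because
      \<open>r n - \<epsilon>\<close> may be negative, while \<open>M\<close> is not.\<close>
    also have "\<dots> \<le> exp (- \<gamma> n) * (M * exp (- S n))"
      using \<open>0 \<le> M\<close> exp_ge_add_one_self[of "- \<gamma> n"] by (intro mult_right_mono) auto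
    also have "\<dots> = M * exp (- S (Suc n))"
      by (simp add: S_def exp_diff exp_minus field_simps)
    finally show ?case .
  qed
  have "filterlim (\<lambda>n. - S n) at_bot sequentially"
    using sum by (simp add: S_def filterlim_uminus_at_bot)
  then have "(\<lambda>n. exp (- S n)) \<longlonglongrightarrow> 0"
    by (rule filterlim_compose[OF exp_at_bot])
  then have "(\<lambda>n. \<epsilon> + M * exp (- S n)) \<longlonglongrightarrow> \<epsilon> + M * 0"
    by (intro tendsto_intros)
  then have "\<forall>\<^sub>F n in sequentially. \<epsilon> + M * exp (- S n) < c"
    using \<open>\<epsilon> < c\<close> by (auto dest: order_tendstoD(2))
  with eventually_ge_at_top[of N] show "\<forall>\<^sub>F n in sequentially. r n < c"
    by eventually_elim (use bound in fastforce)
qed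

theorem theorem5p2:
  fixes C :: "'a::banach set"
    and f :: "'a \<Rightarrow> real"
    and f' :: "'a \<Rightarrow> 'a \<Rightarrow>\<^sub>L real"
    and g :: "'a \<Rightarrow> ereal"
    and \<phi> :: "'a \<Rightarrow> ereal"
    and \<gamma> :: "nat \<Rightarrow> real"
    and x xb :: "nat \<Rightarrow> 'a"
  assumes "C \<noteq> {}" and "closed C" and "bounded C" and "convex C"
    and "convex_on UNIV f"
    and "\<And>z. (f has_derivative blinfun_apply (f' z)) (at z)"
    and "continuous_on UNIV f'"
    and "proper_fun g" and "lsc_fun g" and "convex_fun g"
    and "C \<subseteq> {z. g z < \<infinity>}"
    and "\<phi> = (\<lambda>z. ereal (f z) + g z)"
    and "\<exists>z. is_arg_min \<phi> (\<lambda>y. y \<in> C) z"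
    and "generalized_frank_wolfe C f' g \<gamma> x xb"
    and "uniformly_continuous_on C f'"
    and "\<And>k. 0 < \<gamma> k \<and> \<gamma> k \<le> 1"
    and "\<gamma> \<longlonglongrightarrow> 0"
    and "filterlim (\<lambda>n. \<Sum>k<n. \<gamma> k) at_top sequentially"
  shows "(\<lambda>k. \<phi> (x k)) \<longlonglongrightarrow> (INF z\<in>C. \<phi> z)"
proof -
  \<comment> \<open>\<open>g\<close> is finite on \<open>C\<close>, so there \<open>h\<close>
    carries the same values and the estimates can be made in the reals. The default 0 at infinite
    values is never met on \<open>C\<close>.\<close>
  define h where "h z = real_of_ereal (g z)" for z
  have g_eq: "g z = ereal (h z)" if "z \<in> C" for z
    using that \<open>C \<subseteq> _\<close> \<open>proper_fun g\<close> unfolding h_def proper_fun_def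
    by (cases "g z") auto
  have \<gamma>_pos: "0 < \<gamma> k" and \<gamma>_le: "\<gamma> k \<le> 1" for k
    using assms(16) by auto
  have \<phi>_eq: "\<phi> z = ereal (f z + h z)" if "z \<in> C" for z
    using g_eq[OF that] by (simp add: \<open>\<phi> = _\<close>)
  have xb_C: "xb k \<in> C"
    and xb_min_g: "z \<in> C \<Longrightarrow> ereal (f' (x k) (xb k)) + g (xb k) \<le> ereal (f' (x k) z) + g z"
    and x_Suc: "x (Suc k) = x k + \<gamma> k *\<^sub>R (xb k - x k)" for k z
    using \<open>generalized_frank_wolfe C f' g \<gamma> x xb\<close>
    unfolding generalized_frank_wolfe_def is_arg_min_def by (auto simp: not_less)
  have xb_min: "f' (x k) (xb k) + h (xb k) \<le> f' (x k) z + h z" if "z \<in> C" for k z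
    using xb_min_g[OF that, of k] by (simp add: g_eq that xb_C)
  have segment_C: "a + s *\<^sub>R (b - a) \<in> C" if "a \<in> C" "b \<in> C" "0 \<le> s" "s \<le> 1" for a b s
  proof -
    have "(1 - s) *\<^sub>R a + s *\<^sub>R b \<in> C"
      using \<open>convex C\<close> that by (simp add: convex_alt)
    then show ?thesis by (simp add: algebra_simps)
  qed
  have x_C: "x k \<in> C" for k
  proof (induction k)
    case 0
    show ?case
      using \<open>generalized_frank_wolfe C f' g \<gamma> x xb\<close> by (simp add: generalized_frank_wolfe_def)
  next
    case (Suc k)
    then show ?case
      using segment_C xb_C \<gamma>_pos[of k] \<gamma>_le by (simp add: x_Suc)
  qed
  obtain z\<^sub>0 where z\<^sub>0: "z\<^sub>0 \<in> C" and z\<^sub>0_min: "\<And>y. y \<in> C \<Longrightarrow> \<phi> z\<^sub>0 \<le> \<phi> y"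
    using \<open>\<exists>z. is_arg_min \<phi> (\<lambda>y. y \<in> C) z\<close> by (auto simp: is_arg_min_def not_less)
  have Inf_eq: "(INF z\<in>C. \<phi> z) = \<phi> z\<^sub>0"
    using z\<^sub>0 z\<^sub>0_min by (intro antisym INF_lower INF_greatest)
  obtain B where B: "\<And>z. z \<in> C \<Longrightarrow> norm z \<le> B"
    using \<open>bounded C\<close> by (auto simp: bounded_iff)
  \<comment> \<open>Twice the norm bound dominates the diameter of \<open>C\<close>; the added 1
    makes division by \<open>D\<close> safe.\<close>
  define D where "D = 2 * \<bar>B\<bar> + 1"
  have "0 < D" by (simp add: D_def)
  have diam: "norm (xb k - x k) \<le> D" for k
    using norm_triangle_ineq4[of "xb k" "x k"] B[OF xb_C, of k] B[OF x_C, of k] by (simp add: D_def)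
  define r where "r k = (f (x k) + h (x k)) - (f z\<^sub>0 + h z\<^sub>0)" for k
  have "r \<longlonglongrightarrow> 0"
  proof (rule tendsto_zero_of_eventual_contraction)
    show "0 \<le> r k" for k
      using z\<^sub>0_min[OF x_C] z\<^sub>0 x_C by (simp add: r_def \<phi>_eq)
  next
    fix \<epsilon> :: real assume "0 < \<epsilon>"
    \<comment> \<open>The tolerance for \<open>f'\<close> is scaled by \<open>D\<close> since the
      linearization error carries the factor \<open>norm d\<close>, at most
      \<open>D\<close>.\<close>
    then have "0 < \<epsilon> / D" using \<open>0 < D\<close> by simp
    then obtain \<delta> where "0 < \<delta>"
      and \<delta>: "\<And>a b. \<lbrakk>a \<in> C; b \<in> C; dist b a < \<delta>\<rbrakk> \<Longrightarrow> dist (f' b) (f' a) < \<epsilon> / D"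
      using \<open>uniformly_continuous_on C f'\<close> unfolding uniformly_continuous_on_def by metis
    \<comment> \<open>Such a step keeps the whole segment from \<open>x k\<close> to
      \<open>x (Suc k)\<close> within \<open>\<delta>\<close> of \<open>x k\<close>.\<close>
    have "\<forall>\<^sub>F k in sequentially. \<gamma> k < \<delta> / D"
      using \<open>0 < \<delta>\<close> \<open>0 < D\<close> by (intro order_tendstoD(2)[OF \<open>\<gamma> \<longlonglongrightarrow> 0\<close>]) simp
    then show "\<forall>\<^sub>F k in sequentially. r (Suc k) \<le> (1 - \<gamma> k) * r k + \<gamma> k * \<epsilon>"
    proof eventually_elim
      fix k assume small: "\<gamma> k < \<delta> / D"
      define d where "d = xb k - x k"
      have "norm (f' (x k + s *\<^sub>R d) - f' (x k)) \<le> \<epsilon> / D" if "0 \<le> s" "s \<le> \<gamma> k" for s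
      proof -
        have "x k + s *\<^sub>R d \<in> C"
          using segment_C[OF x_C xb_C] that \<gamma>_le[of k] by (simp add: d_def)
        moreover have "dist (x k + s *\<^sub>R d) (x k) < \<delta>"
        proof -
          have "dist (x k + s *\<^sub>R d) (x k) = s * norm d"
            using that by (simp add: dist_norm)
          also have "\<dots> \<le> \<gamma> k * D"
            using that diam[of k] \<gamma>_pos[of k] unfolding d_def by (intro mult_mono) auto
          also have "\<dots> < \<delta>"
            using small \<open>0 < D\<close> by (simp add: field_simps)
          finally show ?thesis .
        qed
        ultimately have "dist (f' (x k + s *\<^sub>R d)) (f' (x k)) < \<epsilon> / D"
          by (rule \<delta>[OF x_C])
        then show ?thesis by (simp add: dist_norm)
      qed
      from linearization_error_le[OF assms(6) \<gamma>_pos this]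
      have "f (x (Suc k)) \<le> f (x k) + \<gamma> k * f' (x k) d + \<gamma> k * (\<epsilon> / D * norm d)"
        by (simp add: x_Suc d_def)
      also have "\<epsilon> / D * norm d \<le> \<epsilon> / D * D"
        using diam[of k] \<open>0 < \<epsilon> / D\<close> unfolding d_def by (intro mult_left_mono) auto
      finally have f_le: "f (x (Suc k)) \<le> f (x k) + \<gamma> k * f' (x k) d + \<gamma> k * \<epsilon>"
        using \<gamma>_pos[of k] \<open>0 < D\<close> by (simp add: mult_left_mono)
      have "x (Suc k) = (1 - \<gamma> k) *\<^sub>R x k + \<gamma> k *\<^sub>R xb k"
        by (simp add: x_Suc algebra_simps)
      then have "g (x (Suc k)) \<le> ereal (1 - \<gamma> k) * g (x k) + ereal (\<gamma> k) * g (xb k)"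
        using \<open>convex_fun g\<close> \<gamma>_pos[of k] \<gamma>_le[of k] unfolding convex_fun_def by simp
      then have h_le: "h (x (Suc k)) \<le> (1 - \<gamma> k) * h (x k) + \<gamma> k * h (xb k)"
        using g_eq x_C xb_C by simp
      \<comment> \<open>The subproblem is tested against the minimizer \<open>z\<^sub>0\<close>,
        with the constant \<open>f' (x k) (x k)\<close> subtracted from both sides.\<close>
      have "f' (x k) d + h (xb k) \<le> f' (x k) (z\<^sub>0 - x k) + h z\<^sub>0"
        using xb_min[OF z\<^sub>0, of k] by (simp add: d_def blinfun.diff_right)
      also have "\<dots> \<le> f z\<^sub>0 - f (x k) + h z\<^sub>0"
        using convex_on_above_tangent_frechet[OF assms(5,6)] by simp
      finally have "\<gamma> k * (f' (x k) d + h (xb k)) \<le> \<gamma> k * (f z\<^sub>0 - f (x k) + h z\<^sub>0)"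
        using \<gamma>_pos[of k] by (intro mult_left_mono) auto
      \<comment> \<open>In the sum, \<open>- \<gamma> k * f (x k)\<close> from the gradient
        inequality supplies the weight \<open>1 - \<gamma> k\<close> on \<open>f (x k)\<close> that
        convexity already gave for \<open>h (x k)\<close>.\<close>
      with f_le h_le show "r (Suc k) \<le> (1 - \<gamma> k) * r k + \<gamma> k * \<epsilon>"
        by (simp add: r_def algebra_simps)
    qed
  qed (use \<gamma>_le assms(18) in auto)
  then have "(\<lambda>k. r k + (f z\<^sub>0 + h z\<^sub>0)) \<longlonglongrightarrow> 0 + (f z\<^sub>0 + h z\<^sub>0)"
    by (intro tendsto_intros)
  then have "(\<lambda>k. ereal (f (x k) + h (x k))) \<longlonglongrightarrow> ereal (f z\<^sub>0 + h z\<^sub>0)"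
    by (simp add: r_def)
  then show ?thesis
    unfolding Inf_eq using x_C z\<^sub>0 by (simp add: \<phi>_eq)
qed

end
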